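(* Let $\mathcal{T}$ be the class of dependency trees and let $T(z)=\sum_{t\in\mathcal{T}} z^{|t|}$. Let $c$ be an additive parameter on $\mathcal{T}$ with toll function $e$, that is, $c$ and $e$ are real-valued functions on $\mathcal{T}$ satisfying $$c(t)=e(t)+\sum_{r\in t_s}c(r)\qquad\text{for all } t\in\mathcal{T},$$ where the sum is over all the subtrees of the root of $t$. Let $C(z)=\sum_{t\in\mathcal{T}}c(t)z^{|t|}$ and $E(z)=\sum_{t\in\mathcal{T}}e(t)z^{|t|}$ be the cumulative generating functions of $c$ and $e$. Then $$C(z)=\frac{E(z)}{1-2z/\left(1-T(z)\right)^3}=E(z)\left(\frac{1-T(z)}{1-3T(z)}\right).$$
   Context: A dependency tree is defined recursively: it consists of a root node together with a finite (possibly empty) ordered sequence of dependency trees on the left of the root and a finite (possibly empty) ordered sequence of dependency trees on the right of the root (both sequences being empty gives the single-node tree). Equivalently, $\mathcal{T}=\mathrm{SEQ}(\mathcal{T})\times\circ\times\mathrm{SEQ}(\mathcal{T})$, where $\circ$ is the root node (of size 1), $\times$ is the class of ordered pairs, and $\mathrm{SEQ}(\mathcal{A})$ is the class of finite sequences (including the empty one) of elements of $\mathcal{A}$. Nodes are unlabelled; two dependency trees are equal exactly when their left sequences coincide and their right sequences coincide. The size $|t|$ is the total number of nodes of $t$. The subtrees of the root of $t$, denoted $t_s$, are the members of the left sequence and of the right sequence of the root, counted with multiplicity (one for each position in the two sequences). All generating functions are formal power series in $z$; $T(z)$ has zero constant term, so the denominators above are invertible. *)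

theory Defs
  imports Complex_Main "HOL-Computational_Algebra.Formal_Power_Series"
begin

datatype dep_tree = Node (left_subtrees: "dep_tree list") (right_subtrees: "dep_tree list")

definition root_subtrees :: "dep_tree \<Rightarrow> dep_tree list" where
  "root_subtrees t = left_subtrees t @ right_subtrees t"

(* The number of nodes; the datatype's own size function counts list constructors as well. *)
primrec num_nodes :: "dep_tree \<Rightarrow> nat" where
  "num_nodes (Node ls rs) = 1 + sum_list (map num_nodes ls) + sum_list (map num_nodes rs)"

definition additive_parameter :: "(dep_tree \<Rightarrow> real) \<Rightarrow> (dep_tree \<Rightarrow> real) \<Rightarrow> bool" where
  "additive_parameter c e \<longleftrightarrow> (\<forall>t. c t = e t + (\<Sum>r\<leftarrow>root_subtrees t. c r))"

(* The formal power series whose n-th coefficient collects the trees with n nodes;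
   the inner sum ranges over a finite set by finite_num_nodes below. *)
definition cumulative_gf :: "(dep_tree \<Rightarrow> real) \<Rightarrow> real fps" where
  "cumulative_gf w = Abs_fps (\<lambda>n. \<Sum>t | num_nodes t = n. w t)"

definition tree_gf :: "real fps" where
  "tree_gf = cumulative_gf (\<lambda>_. 1)"

lemma num_nodes_pos: "num_nodes t \<ge> 1"
  by (cases t) simp

lemma length_le_sum_num_nodes: "length ts \<le> sum_list (map num_nodes ts)"
proof (induction ts)
  case (Cons t ts)
  then show ?case using num_nodes_pos[of t] by simp
qed simp

lemma finite_num_nodes_le: "finite {t. num_nodes t \<le> n}"
proof (induction n)
  case 0
  have "{t. num_nodes t \<le> 0} = {}"
    using num_nodes_pos by (auto simp: not_le less_eq_Suc_le)
  then show ?case by (simp only: finite.emptyI)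
next
  case (Suc n)
  let ?L = "{ts. set ts \<subseteq> {t. num_nodes t \<le> n} \<and> length ts \<le> n}"
  have L: "ts \<in> ?L" if "sum_list (map num_nodes ts) \<le> n" for ts
    using that length_le_sum_num_nodes[of ts] member_le_sum_list[of _ "map num_nodes ts"]
    by fastforce
  have "t \<in> (\<lambda>(ls, rs). Node ls rs) ` (?L \<times> ?L)" if "num_nodes t \<le> Suc n" for t
  proof (cases t)
    case (Node ls rs)
    then have "ls \<in> ?L" "rs \<in> ?L" using that by (auto intro!: L simp del: mem_Collect_eq)
    then show ?thesis unfolding Node by blast
  qed
  then have "{t. num_nodes t \<le> Suc n} \<subseteq> (\<lambda>(ls, rs). Node ls rs) ` (?L \<times> ?L)"
    by blast
  moreover have "finite ?L"
    by (rule finite_lists_length_le[OF Suc.IH])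
  ultimately show ?case
    by (meson finite_SigmaI finite_imageI finite_subset)
qed

lemma finite_num_nodes: "finite {t. num_nodes t = n}"
  by (rule finite_subset[OF _ finite_num_nodes_le[of n]]) auto

(* The denominators in the statement have nonzero constant term, so that fps division
   by them is multiplication by the inverse. *)
lemma tree_gf_nth_0: "fps_nth tree_gf 0 = 0"
proof -
  have "{t. num_nodes t = 0} = {}"
    using num_nodes_pos by (metis (mono_tags, lifting) Collect_empty_eq not_one_le_zero)
  then show ?thesis
    unfolding tree_gf_def cumulative_gf_def fps_nth_Abs_fps by (simp only: sum.empty)
qed

end

(* The symbolic method: sequences of trees are empty or a tree followed by a sequence, and a tree is
   a root with two sequences.  Writing S for the generating function of sequences and L for that of
   the sequences weighted by the sum of c over their members, this gives S = 1 + T S,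
   L = C S + T L, T = z S^2 and C = E + 2 z L S.  Eliminating L yields C (1 - 2 z S^3) = E with
   S = 1 / (1 - T), and z = T (1 - T)^2 gives the second form of the denominator. *)
theory Submission
  imports Defs
begin

text \<open>Generalises \<open>cumulative_gf\<close> to any type with a size function, so that one
  product rule serves trees, forests and pairs. A coefficient whose fibre is infinite would be 0 by
  the convention for \<open>sum\<close>; hence the finiteness assumptions below.\<close>

definition weighted_gf :: "('a \<Rightarrow> nat) \<Rightarrow> ('a \<Rightarrow> 'b::comm_monoid_add) \<Rightarrow> 'b fps" where
  "weighted_gf s w = Abs_fps (\<lambda>n. \<Sum>x | s x = n. w x)"

lemma weighted_gf_nth [simp]: "fps_nth (weighted_gf s w) n = (\<Sum>x | s x = n. w x)"
  by (simp add: weighted_gf_def)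

lemma weighted_gf_add:
  "weighted_gf s (\<lambda>x. u x + v x) = weighted_gf s u + weighted_gf s v"
  by (rule fps_ext) (simp add: sum.distrib)

text \<open>Pairs of total size \<open>n\<close> split disjointly by the size \<open>i\<close> of
  the first component, and on each rectangle the weight factorises: this is the Cauchy
  product.\<close>

lemma weighted_gf_prod:
  fixes u :: "'a \<Rightarrow> 'c::semiring_0" and v :: "'b \<Rightarrow> 'c"
  assumes s: "\<And>n. finite {x. s x = n}" and t: "\<And>n. finite {y. t y = n}"
  shows "weighted_gf (\<lambda>(x, y). s x + t y) (\<lambda>(x, y). u x * v y) = weighted_gf s u * weighted_gf t v"
proof (rule fps_ext)
  fix n
  let ?A = "\<lambda>i. {x. s x = i} \<times> {y. t y = n - i}"
  have "{p. (case p of (x, y) \<Rightarrow> s x + t y) = n} = (\<Union>i\<in>{0..n}. ?A i)"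
    by auto
  then have "fps_nth (weighted_gf (\<lambda>(x, y). s x + t y) (\<lambda>(x, y). u x * v y)) n
      = (\<Sum>p\<in>(\<Union>i\<in>{0..n}. ?A i). case p of (x, y) \<Rightarrow> u x * v y)"
    by simp
  also have "\<dots> = (\<Sum>i=0..n. \<Sum>p\<in>?A i. case p of (x, y) \<Rightarrow> u x * v y)"
    by (rule sum.UNION_disjoint) (auto intro: s t)
  also have "\<dots> = fps_nth (weighted_gf s u * weighted_gf t v) n"
    by (simp add: fps_mult_nth sum_product sum.cartesian_product)
  finally show "fps_nth (weighted_gf (\<lambda>(x, y). s x + t y) (\<lambda>(x, y). u x * v y)) n
      = fps_nth (weighted_gf s u * weighted_gf t v) n" .
qed

text \<open>Splits lists into \<open>[]\<close>, which has size 0 and gives the constant term, and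
  the image of the pairs of head and tail under the injective Cons.\<close>

lemma weighted_gf_list:
  fixes s :: "'a \<Rightarrow> nat" and w :: "'a list \<Rightarrow> 'b::semiring_1"
  assumes fin: "\<And>n. finite {xs. sum_list (map s xs) = n}"
  shows "weighted_gf (\<lambda>xs. sum_list (map s xs)) w
    = fps_const (w []) + weighted_gf (\<lambda>(x, xs). s x + sum_list (map s xs)) (\<lambda>(x, xs). w (x # xs))"
proof (rule fps_ext)
  fix n
  let ?l = "\<lambda>xs. sum_list (map s xs)"
  let ?P = "{p. (case p of (x, xs) \<Rightarrow> s x + ?l xs) = n}"
  let ?f = "\<lambda>(x, xs). x # xs"
  have inj: "inj_on ?f ?P"
    by (auto simp: inj_on_def)
  have split: "{xs. ?l xs = n} = (if n = 0 then {[]} else {}) \<union> ?f ` ?P"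
  proof (rule set_eqI)
    show "xs \<in> {xs. ?l xs = n} \<longleftrightarrow> xs \<in> (if n = 0 then {[]} else {}) \<union> ?f ` ?P" for xs
      by (cases xs) (auto simp: image_iff)
  qed
  have "finite (?f ` ?P)"
    using fin[of n] unfolding split by simp
  then have "(\<Sum>xs | ?l xs = n. w xs)
      = (\<Sum>xs\<in>(if n = 0 then {[]} else {}). w xs) + (\<Sum>xs\<in>?f ` ?P. w xs)"
    unfolding split by (intro sum.union_disjoint) auto
  also have "(\<Sum>xs\<in>?f ` ?P. w xs) = (\<Sum>p\<in>?P. case p of (x, xs) \<Rightarrow> w (x # xs))"
    by (subst sum.reindex[OF inj]) (simp add: case_prod_unfold)
  finally show "fps_nth (weighted_gf ?l w) n
    = fps_nth (fps_const (w []) + weighted_gf (\<lambda>(x, xs). s x + ?l xs) (\<lambda>(x, xs). w (x # xs))) n"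
    by simp
qed

abbreviation forest_size :: "dep_tree list \<Rightarrow> nat" where
  "forest_size ts \<equiv> sum_list (map num_nodes ts)"

abbreviation forest_gf :: "(dep_tree list \<Rightarrow> real) \<Rightarrow> real fps" where
  "forest_gf \<equiv> weighted_gf forest_size"

text \<open>Putting a forest to the left of a new root embeds it injectively into the trees with one
  more node.\<close>

lemma finite_forest_size: "finite {ts. forest_size ts = n}"
proof (rule finite_imageD)
  show "finite ((\<lambda>ts. Node ts []) ` {ts. forest_size ts = n})"
    by (rule finite_subset[OF _ finite_num_nodes[of "Suc n"]]) auto
qed (auto simp: inj_on_def)

lemma cumulative_gf_eq_weighted_gf: "cumulative_gf = weighted_gf num_nodes"
  by (simp add: fun_eq_iff cumulative_gf_def weighted_gf_def)

text \<open>The factor \<open>fps_X\<close> accounts for the root; at \<open>n = 0\<close> both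
  sides vanish because every tree has a node.\<close>

lemma cumulative_gf_Node:
  "cumulative_gf w = fps_X * weighted_gf (\<lambda>(ls, rs). forest_size ls + forest_size rs)
     (\<lambda>(ls, rs). w (Node ls rs))"
proof (rule fps_ext)
  fix n
  let ?P = "\<lambda>m. {p. (case p of (ls, rs) \<Rightarrow> forest_size ls + forest_size rs) = m}"
  let ?f = "\<lambda>(ls, rs). Node ls rs"
  show "fps_nth (cumulative_gf w) n = fps_nth (fps_X *
      weighted_gf (\<lambda>(ls, rs). forest_size ls + forest_size rs) (\<lambda>(ls, rs). w (Node ls rs))) n"
  proof (cases n)
    case 0
    have "{t. num_nodes t = 0} = {}"
      using num_nodes_pos by (metis (mono_tags, lifting) Collect_empty_eq not_one_le_zero)
    then show ?thesis
      unfolding 0 cumulative_gf_eq_weighted_gf weighted_gf_nth by (simp only: sum.empty) simp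
  next
    case (Suc m)
    have inj: "inj_on ?f (?P m)"
      by (auto simp: inj_on_def)
    have img: "{t. num_nodes t = Suc m} = ?f ` ?P m"
    proof (rule set_eqI)
      show "t \<in> {t. num_nodes t = Suc m} \<longleftrightarrow> t \<in> ?f ` ?P m" for t
        by (cases t) (auto simp: image_iff)
    qed
    show ?thesis
      unfolding Suc cumulative_gf_eq_weighted_gf weighted_gf_nth img
      by (subst sum.reindex[OF inj]) (simp add: case_prod_unfold)
  qed
qed

lemma forest_gf_one: "forest_gf (\<lambda>_. 1) = 1 + tree_gf * forest_gf (\<lambda>_. 1)"
proof -
  \<comment> \<open>The weight 1 is written as \<open>1 * 1\<close> to match the product form of
    \<open>weighted_gf_prod\<close>.\<close>
  have "forest_gf (\<lambda>_. 1) = 1 + weighted_gf (\<lambda>(t, ts). num_nodes t + forest_size ts) (\<lambda>(t, ts). 1 * 1)"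
    by (subst weighted_gf_list[OF finite_forest_size]) (simp add: case_prod_unfold)
  also have "\<dots> = 1 + tree_gf * forest_gf (\<lambda>_. 1)"
    unfolding weighted_gf_prod[OF finite_num_nodes finite_forest_size]
    by (simp only: tree_gf_def cumulative_gf_eq_weighted_gf)
  finally show ?thesis .
qed

lemma forest_gf_sum_list:
  "forest_gf (\<lambda>ts. \<Sum>t\<leftarrow>ts. c t)
     = cumulative_gf c * forest_gf (\<lambda>_. 1) + tree_gf * forest_gf (\<lambda>ts. \<Sum>t\<leftarrow>ts. c t)"
proof -
  let ?s = "\<lambda>(t, ts). num_nodes t + forest_size ts"
  have "forest_gf (\<lambda>ts. \<Sum>t\<leftarrow>ts. c t)
      = weighted_gf ?s (\<lambda>p. (case p of (t, ts) \<Rightarrow> c t * 1) + (case p of (t, ts) \<Rightarrow> 1 * (\<Sum>t\<leftarrow>ts. c t)))"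
    by (subst weighted_gf_list[OF finite_forest_size]) (simp add: case_prod_unfold)
  also have "\<dots> = cumulative_gf c * forest_gf (\<lambda>_. 1) + tree_gf * forest_gf (\<lambda>ts. \<Sum>t\<leftarrow>ts. c t)"
    unfolding weighted_gf_add weighted_gf_prod[OF finite_num_nodes finite_forest_size]
    by (simp only: tree_gf_def cumulative_gf_eq_weighted_gf)
  finally show ?thesis .
qed

lemma tree_gf_eq: "tree_gf = fps_X * (forest_gf (\<lambda>_. 1))\<^sup>2"
proof -
  have "tree_gf = fps_X * weighted_gf (\<lambda>(ls, rs). forest_size ls + forest_size rs) (\<lambda>(ls, rs). 1 * 1)"
    unfolding tree_gf_def by (subst cumulative_gf_Node) (simp add: case_prod_unfold)
  then show ?thesis
    unfolding weighted_gf_prod[OF finite_forest_size finite_forest_size] power2_eq_square .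
qed

lemma cumulative_gf_additive:
  assumes "additive_parameter c e"
  shows "cumulative_gf c
    = cumulative_gf e + 2 * fps_X * forest_gf (\<lambda>ts. \<Sum>t\<leftarrow>ts. c t) * forest_gf (\<lambda>_. 1)"
proof -
  let ?r = "\<lambda>t. \<Sum>r\<leftarrow>root_subtrees t. c r"
  let ?s = "\<lambda>(ls, rs). forest_size ls + forest_size rs"
  have "c = (\<lambda>t. e t + ?r t)"
    using assms unfolding additive_parameter_def by (intro ext) (rule spec)
  then have "cumulative_gf c = cumulative_gf (\<lambda>t. e t + ?r t)"
    by (rule arg_cong)
  also have "\<dots> = cumulative_gf e + cumulative_gf ?r"
    unfolding cumulative_gf_eq_weighted_gf by (rule weighted_gf_add)
  also have "cumulative_gf ?r = fps_X * weighted_gf ?s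
      (\<lambda>p. (case p of (ls, rs) \<Rightarrow> (\<Sum>t\<leftarrow>ls. c t) * 1) + (case p of (ls, rs) \<Rightarrow> 1 * (\<Sum>t\<leftarrow>rs. c t)))"
    by (subst cumulative_gf_Node) (simp add: root_subtrees_def case_prod_unfold)
  \<comment> \<open>Left and right sequences contribute equal products, whence the factor 2.\<close>
  also have "\<dots> = 2 * fps_X * forest_gf (\<lambda>ts. \<Sum>t\<leftarrow>ts. c t) * forest_gf (\<lambda>_. 1)"
    unfolding weighted_gf_add weighted_gf_prod[OF finite_forest_size finite_forest_size]
    by (simp add: algebra_simps)
  finally show ?thesis .
qed

theorem mainTheorem4:
  fixes c e :: "dep_tree \<Rightarrow> real"
  assumes "additive_parameter c e"
  shows "cumulative_gf c = cumulative_gf e / (1 - 2 * fps_X / (1 - tree_gf) ^ 3)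
       \<and> cumulative_gf e / (1 - 2 * fps_X / (1 - tree_gf) ^ 3)
         = cumulative_gf e * ((1 - tree_gf) / (1 - 3 * tree_gf))"
proof -
  define T where "T = tree_gf"
  define C where "C = cumulative_gf c"
  define E where "E = cumulative_gf e"
  define S where "S = forest_gf (\<lambda>_. 1)"
  define L where "L = forest_gf (\<lambda>ts. \<Sum>t\<leftarrow>ts. c t)"
  define D where "D = 1 - 2 * fps_X * S ^ 3"
  have T0: "fps_nth T 0 = 0"
    by (simp add: T_def tree_gf_nth_0)
  have "S = 1 + T * S"
    unfolding S_def T_def by (rule forest_gf_one)
  then have ST: "S * (1 - T) = 1"
    by algebra
  have "L = C * S + T * L"
    unfolding L_def C_def S_def T_def by (rule forest_gf_sum_list)
  \<comment> \<open>From \<open>L * (1 - T) = C * S\<close>, multiplied by \<open>S\<close>.\<close>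
  then have L: "L = C * S\<^sup>2"
    using ST by algebra
  have "C = E + 2 * fps_X * L * S"
    using cumulative_gf_additive[OF assms] by (simp add: C_def E_def L_def S_def)
  then have CE: "C * D = E"
    unfolding D_def L by algebra
  have "T = fps_X * S\<^sup>2"
    using tree_gf_eq by (simp add: T_def S_def)
  \<comment> \<open>Here \<open>2 * fps_X * S ^ 3 * (1 - T)\<close> reduces to
    \<open>2 * fps_X * S\<^sup>2\<close>, which is \<open>2 * T\<close>.\<close>
  then have DT: "D * (1 - T) = 1 - 3 * T"
    unfolding D_def using ST by algebra
  have D0: "fps_nth D 0 \<noteq> 0"
    by (simp add: D_def mult.assoc)
  \<comment> \<open>A nonzero constant term makes \<open>h\<close> nonzero, so division cancels it.
    This turns each polynomial identity into a quotient.\<close>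
  have eq_divide: "f = g / h" if "f * h = g" "fps_nth h 0 \<noteq> 0" for f g h :: "real fps"
    using that by (metis fps_nonzero_nth nonzero_mult_div_cancel_right)
  have "2 * fps_X * S ^ 3 = 2 * fps_X / (1 - T) ^ 3"
  proof (rule eq_divide)
    show "2 * fps_X * S ^ 3 * (1 - T) ^ 3 = 2 * fps_X"
      using ST by algebra
  qed (simp add: T0 fps_power_zeroth)
  then have D: "1 - 2 * fps_X / (1 - T) ^ 3 = D"
    by (simp add: D_def)
  have C1: "C = E / D"
    using CE D0 by (rule eq_divide)
  have "inverse D = (1 - T) / (1 - 3 * T)"
  proof (rule eq_divide)
    \<comment> \<open>Multiply \<open>DT\<close> by \<open>inverse D\<close>, a true inverse because
      \<open>D\<close> has nonzero constant term.\<close>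
    show "inverse D * (1 - 3 * T) = 1 - T"
      using inverse_mult_eq_1[OF D0] DT by (metis mult.assoc mult_1)
  qed (simp add: T0)
  then have "E / D = E * ((1 - T) / (1 - 3 * T))"
    using D0 by (simp add: fps_divide_unit)
  with C1 D show ?thesis
    by (simp add: T_def C_def E_def)
qed

end
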